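(* Let $\mathbb{F}_q$ be a finite field with $q$ elements, and let $C \subseteq \mathbb{F}_q^n$ be a code of size $|C|$ with minimum distance $d$ and minimum relative distance $\delta=\frac{d}{n}\le 1-\frac1q$. Set $$ e := \lceil nJ_q(\delta)\rceil - 1, $$ and assume $e\ge 1$. Then $$ R_C \le 1 - H_q\!\left(\frac{e}{n}\right) + \frac{1}{2n}\log_{q}\!\left(2\pi \frac{e}{n}\Bigl(1-\frac{e}{n}\Bigr)n \right) +\frac{1}{n}\log_{q}\!\left(qn^2 \delta \right) +\frac{1}{n \ln q}\left(\frac{1}{12n}+\frac{1}{12e+1}+\frac{1}{12(n-e)+1}\right), $$ where $R_C=\frac{\log_q|C|}{n}$. In particular, the rate $$R=\sup\{R_C : C \subseteq \mathbb{F}_q^n \text{ is a code with minimum relative distance } \delta\}$$ satisfies the same inequality.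
   Context: A code is a subset $C\subseteq\mathbb{F}_q^n$ (not necessarily linear). The Hamming weight $|x|$ of $x\in\mathbb{F}_q^n$ is the number of non-zero entries of $x$, the Hamming distance between $x$ and $y$ is $|x-y|$, and the minimum distance of $C$ is the minimum Hamming distance between distinct elements of $C$. The $q$-ary entropy function and the Johnson radius are, for $x,\delta\in[0,\frac{q-1}{q}]$, $$H_q(x) = x \log_q(q-1) - x \log_q x - (1 - x) \log_q(1 - x),$$ $$J_q(\delta) = \left(1 - \frac{1}{q} \right) \left(1 - \sqrt{1 - \frac{q}{q-1}\, \delta} \right).$$ *)

theory Defs
  imports "HOL-Analysis.Analysis"
begin

text \<open>Words of length \<open>n = CARD('n)\<close> over a finite field \<open>'a\<close> with \<open>q = CARD('a)\<close> elements are
  vectors of type \<open>'a ^ 'n\<close>; a code is an arbitrary set of such vectors.\<close>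

definition hamming_weight :: "'a::zero ^ 'n \<Rightarrow> nat" where
  "hamming_weight x = card {i. x $ i \<noteq> 0}"

definition hamming_dist :: "'a::group_add ^ 'n \<Rightarrow> 'a ^ 'n \<Rightarrow> nat" where
  "hamming_dist x y = hamming_weight (x - y)"

text \<open>The infimum over the natural numbers is attained as soon as \<open>C\<close> has two distinct elements.
  Otherwise there is no minimum distance, and the expression has the junk value \<open>0\<close>, which
  no code with at least two elements takes.\<close>

definition min_distance :: "('a::group_add ^ 'n) set \<Rightarrow> nat" where
  "min_distance C = Inf {hamming_dist x y |x y. x \<in> C \<and> y \<in> C \<and> x \<noteq> y}"

definition min_rel_distance :: "('a::group_add ^ 'n) set \<Rightarrow> real" where
  "min_rel_distance C = real (min_distance C) / real CARD('n)"

definition code_rate :: "('a ^ 'n) set \<Rightarrow> real" where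
  "code_rate C = log (real CARD('a)) (real (card C)) / real CARD('n)"

definition q_entropy :: "nat \<Rightarrow> real \<Rightarrow> real" where
  "q_entropy q x = x * log (real q) (real q - 1) - x * log (real q) x
     - (1 - x) * log (real q) (1 - x)"

definition johnson_radius :: "nat \<Rightarrow> real \<Rightarrow> real" where
  "johnson_radius q \<delta> = (1 - 1 / real q) * (1 - sqrt (1 - real q / (real q - 1) * \<delta>))"

end

theory Submission
  imports Defs
begin

text \<open>The bound combines the Johnson bound for list decoding with a packing argument of
  Elias--Bassalygo type. Let \<open>e\<close> be an integer below the Johnson radius of a code with minimum
  distance \<open>d\<close>, that is, \<open>q * e < (q - 1) * n\<close> and the integer

    \<open>D = q * e^2 - 2 * (q - 1) * n * e + (q - 1) * n * d\<close>

  is positive. Counting disagreements among the codewords in a Hamming ball of radius \<open>e\<close> shows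
  that there are at most \<open>(q - 1) * n * d / D\<close> of them (\<open>johnson_list_bound\<close>). If every word of the
  space lies in so few of the balls around codewords, then \<open>|C| * V * D \<le> q^n * (q - 1) * n * d\<close>
  with \<open>V\<close> the size of such a ball (\<open>packing_bound\<close>). Since \<open>V\<close> exceeds
  \<open>(n choose e) * (q - 1)^e\<close>, taking logarithms and estimating the factorials by Stirling's
  formula gives the entropy term and the term with \<open>2 * pi\<close>.

  The delicate point is the last, smallest term of the bound. Stirling's formula with the remainder
  \<open>0 \<le> r(m) \<le> 1/(12*m)\<close> estimates the binomial coefficient with the error terms \<open>1/(12*e)\<close> and
  \<open>1/(12*(n-e))\<close>, whereas the claim has the smaller \<open>1/(12*e+1)\<close> and \<open>1/(12*(n-e)+1)\<close>, plus
  \<open>1/(12*n)\<close>. The corresponding estimate of \<open>n choose e\<close> alone is false, for example for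
  \<open>e = 1\<close> and large \<open>n\<close>. The difference is instead recovered from what the
  usual form of the argument gives away: the factor \<open>(q - 1) / q\<close>, the integrality of \<open>D\<close>, and the
  words of weight \<open>e - 1\<close> in the ball (\<open>stirling_gap_absorbed\<close>).\<close>

section \<open>Stirling's formula with remainder bounds\<close>

text \<open>The factor \<open>sqrt (2 * pi)\<close> of Stirling's formula is not split off here: that
  \<open>ln (2 * pi) / 2\<close> is the limit of this sequence is proved only below.\<close>

definition stirling_remainder :: "nat \<Rightarrow> real" where
  "stirling_remainder m = ln (fact m) - ((real m + 1 / 2) * ln m - m)"

text \<open>The power series of the left-hand side is \<open>2 * (x + x^3/3 + x^5/5 + ...)\<close>; replacing all
  later coefficients by \<open>1/3\<close> gives the right-hand side. In the proof this is a comparison of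
  derivatives.\<close>

lemma ln_quotient_le_cubic:
  fixes x :: real
  assumes "0 \<le> x" "x < 1"
  shows "ln ((1 + x) / (1 - x)) \<le> 2 * x + 2 / 3 * (x ^ 3 / (1 - x\<^sup>2))"
proof -
  let ?h = "\<lambda>x::real. 2 * x + 2 / 3 * (x ^ 3 / (1 - x\<^sup>2)) - ln (1 + x) + ln (1 - x)"
  have "\<exists>D. (?h has_field_derivative D) (at y) \<and> D \<ge> 0" if y: "0 \<le> y" "y \<le> x" for y
  proof -
    have pos: "1 - y > 0" "1 + y > 0" using y assms by auto
    then have "(1 - y) * (1 + y) > 0" by simp
    then have sq: "1 - y\<^sup>2 > 0" by (simp add: algebra_simps power2_eq_square)
    have "((\<lambda>y. y ^ 3 / (1 - y\<^sup>2)) has_field_derivative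
        (3 * y\<^sup>2 * (1 - y\<^sup>2) - y ^ 3 * (- 2 * y)) / ((1 - y\<^sup>2) * (1 - y\<^sup>2))) (at y)"
      using sq by (auto intro!: derivative_eq_intros)
    from DERIV_cmult[OF this, of "2 / 3"]
    have "((\<lambda>y. 2 / 3 * (y ^ 3 / (1 - y\<^sup>2))) has_field_derivative
        2 / 3 * ((3 * y\<^sup>2 * (1 - y\<^sup>2) - y ^ 3 * (- 2 * y)) / ((1 - y\<^sup>2) * (1 - y\<^sup>2)))) (at y)" .
    moreover have "((\<lambda>y. 2 * y) has_field_derivative 2) (at y)"
      by (auto intro!: derivative_eq_intros)
    moreover have "((\<lambda>y. ln (1 + y)) has_field_derivative 1 / (1 + y)) (at y)"
      and "((\<lambda>y. ln (1 - y)) has_field_derivative - 1 / (1 - y)) (at y)"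
      using pos by (auto intro!: derivative_eq_intros)
    ultimately have "(?h has_field_derivative
        2 + 2 / 3 * ((3 * y\<^sup>2 * (1 - y\<^sup>2) - y ^ 3 * (- 2 * y)) / ((1 - y\<^sup>2) * (1 - y\<^sup>2)))
        - 1 / (1 + y) + - 1 / (1 - y)) (at y)"
      by (intro DERIV_add DERIV_diff)
    moreover have "2 + 2 / 3 * ((3 * y\<^sup>2 * (1 - y\<^sup>2) - y ^ 3 * (- 2 * y)) / ((1 - y\<^sup>2) * (1 - y\<^sup>2)))
        - 1 / (1 + y) + - 1 / (1 - y) = 4 / 3 * (y ^ 4 / (1 - y\<^sup>2)\<^sup>2)"
    proof -
      have "1 / (1 + y) + 1 / (1 - y) = 2 / (1 - y\<^sup>2)"
        using pos sq by (simp add: divide_simps) (simp add: algebra_simps power2_eq_square)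
      moreover have "2 + 2 / 3 * ((3 * y\<^sup>2 * (1 - y\<^sup>2) - y ^ 3 * (- 2 * y)) / ((1 - y\<^sup>2) * (1 - y\<^sup>2)))
          - 2 / (1 - y\<^sup>2) = 4 / 3 * (y ^ 4 / (1 - y\<^sup>2)\<^sup>2)"
        using sq by (simp add: divide_simps) (simp add: algebra_simps eval_nat_numeral)
      moreover have "- 1 / (1 - y) = - (1 / (1 - y))" by simp
      ultimately show ?thesis by linarith
    qed
    ultimately show ?thesis by (intro exI conjI) auto
  qed
  then have "?h 0 \<le> ?h x"
    using assms by (intro DERIV_nonneg_imp_nondecreasing[of 0 x ?h]) auto
  then show ?thesis using assms by (simp add: ln_div)
qed

text \<open>One step of the remainder equals \<open>(m + 1/2) * ln (1 + 1/m) - 1\<close>. With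
  \<open>x = 1 / (2*m + 1)\<close> one has \<open>1 + 1/m = (1 + x) / (1 - x)\<close>, so the previous bound makes the step
  at most \<open>x^2 / (3 * (1 - x^2)) = 1/(12*m) - 1/(12*(m+1))\<close>, a telescoping difference.\<close>

lemma stirling_remainder_Suc:
  assumes "m > 0"
  shows "stirling_remainder (Suc m) \<le> stirling_remainder m"
    and "stirling_remainder m - 1 / (12 * real m) \<le> stirling_remainder (Suc m) - 1 / (12 * real (Suc m))"
proof -
  define x where "x = 1 / (2 * real m + 1)"
  have m: "real m > 0" using assms by simp
  have diff: "stirling_remainder m - stirling_remainder (Suc m)
      = (real m + 1 / 2) * (ln (m + 1) - ln m) - 1"
    unfolding stirling_remainder_def fact_Suc
    using m by (simp add: ln_mult_pos del: of_nat_Suc) (simp add: algebra_simps)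
  have "ln (m + 1) - ln m \<ge> 2 * (real (m + 1) - m) / (real m + (m + 1))"
    using m by (intro ln_inverse_approx_ge) auto
  then have "(real m + 1 / 2) * (ln (m + 1) - ln m) \<ge> 1"
    using m by (simp add: field_simps)
  with diff show "stirling_remainder (Suc m) \<le> stirling_remainder m" by simp
  have x: "0 \<le> x" "x < 1" using m by (auto simp: x_def)
  have "(1 + x) / (1 - x) = (m + 1) / m"
    using m by (simp add: x_def divide_simps)
  then have "ln (m + 1) - ln m = ln ((1 + x) / (1 - x))"
    using m by (simp add: ln_div)
  also have "\<dots> \<le> 2 * x + 2 / 3 * (x ^ 3 / (1 - x\<^sup>2))"
    by (rule ln_quotient_le_cubic[OF x])
  also have "\<dots> = 2 * x * (1 + 1 / 3 * (x\<^sup>2 / (1 - x\<^sup>2)))"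
    by (simp add: algebra_simps eval_nat_numeral)
  also have "x\<^sup>2 / (1 - x\<^sup>2) = 1 / (4 * real m * (real m + 1))"
  proof -
    have "1 - x\<^sup>2 = 4 * real m * (real m + 1) * x\<^sup>2"
      using m by (simp add: x_def power2_eq_square divide_simps) (simp add: algebra_simps)
    moreover have "x\<^sup>2 > 0" using m by (simp add: x_def)
    ultimately show ?thesis by simp
  qed
  finally have "(real m + 1 / 2) * (ln (m + 1) - ln m)
      \<le> (real m + 1 / 2) * (2 * x * (1 + 1 / 3 * (1 / (4 * real m * (real m + 1)))))"
    by (intro mult_left_mono) auto
  also have "\<dots> = 1 + 1 / 12 * (1 / (real m * (real m + 1)))"
    using m by (simp add: x_def divide_simps) algebra
  also have "1 / (real m * (real m + 1)) = 1 / m - 1 / (m + 1)"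
    using m by (simp add: divide_simps)
  finally have le: "(real m + 1 / 2) * (ln (m + 1) - ln m) \<le> 1 + 1 / 12 * (1 / m - 1 / (m + 1))" .
  have "1 / (12 * real m) = 1 / 12 * (1 / m)" "1 / (12 * real (Suc m)) = 1 / 12 * (1 / (m + 1))"
    by simp_all
  with diff le show "stirling_remainder m - 1 / (12 * real m) \<le> stirling_remainder (Suc m) - 1 / (12 * real (Suc m))"
    by (simp only: right_diff_distrib)
qed

lemma decseq_stirling_remainder: "decseq (\<lambda>n. stirling_remainder (Suc n))"
  by (rule decseq_SucI) (simp add: stirling_remainder_Suc)

lemma incseq_stirling_remainder:
  "incseq (\<lambda>n. stirling_remainder (Suc n) - 1 / (12 * real (Suc n)))"
  by (rule incseq_SucI) (rule stirling_remainder_Suc(2)[OF zero_less_Suc])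

lemma wallis_product_eq_fact:
  "(\<Prod>k=1..n. (4 * real k ^ 2) / (4 * real k ^ 2 - 1))
     = 16 ^ n * fact n ^ 4 / ((fact (2 * n))\<^sup>2 * (2 * n + 1))"
proof (induction n)
  case (Suc n)
  let ?f = "\<lambda>k. (4 * real k ^ 2) / (4 * real k ^ 2 - 1)"
  have denominator: "4 * real (Suc n) ^ 2 - 1 = (2 * real n + 1) * (2 * real n + 3)"
    by (simp add: algebra_simps power2_eq_square)
  have double: "fact (2 * Suc n) = (2 * real n + 2) * ((2 * real n + 1) * fact (2 * n))"
    by (simp add: algebra_simps)
  have single: "fact (Suc n) = (real n + 1) * fact n" by simp
  have cancel: "P * F ^ 4 / (G\<^sup>2 * b) * (4 * a\<^sup>2 / (b * c)) = 16 * P * (a * F) ^ 4 / ((2 * a * (b * G))\<^sup>2 * c)"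
    if "a > 0" "b > 0" "c > 0" "G > 0" for a b c P F G :: real
    using that by (simp add: divide_simps power_mult_distrib) (simp add: eval_nat_numeral)
  have "(\<Prod>k=1..Suc n. ?f k) = (\<Prod>k=1..n. ?f k) * ?f (Suc n)" by simp
  also have "\<dots> = 16 ^ n * fact n ^ 4 / ((fact (2 * n))\<^sup>2 * (2 * real n + 1))
      * (4 * (real n + 1)\<^sup>2 / ((2 * real n + 1) * (2 * real n + 3)))"
    unfolding Suc.IH denominator by (simp add: add.commute)
  also have "\<dots> = 16 ^ Suc n * fact (Suc n) ^ 4 / ((fact (2 * Suc n))\<^sup>2 * (2 * real (Suc n) + 1))"
    unfolding double single
    using cancel[of "real n + 1" "2 * real n + 1" "2 * real n + 3" "fact (2 * n)" "16 ^ n" "fact n"]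
    by (simp add: algebra_simps)
  finally show ?case .
qed simp

text \<open>The remainder converges by monotonicity. If \<open>c\<close> is its limit, the Wallis product at \<open>n\<close>,
  written with factorials, has a logarithm tending to \<open>4 * c - 2 * c - 2 * ln 2\<close>, and this must be
  \<open>ln (pi / 2)\<close>.\<close>

lemma stirling_remainder_LIMSEQ: "stirling_remainder \<longlonglongrightarrow> ln (2 * pi) / 2"
proof -
  let ?r = "\<lambda>n. stirling_remainder (Suc n)"
  note dec = decseq_stirling_remainder and inc = incseq_stirling_remainder
  have "?r n \<ge> ?r 0 - 1 / 12" for n
  proof -
    have "?r 0 - 1 / (12 * real (Suc 0)) \<le> ?r n - 1 / (12 * real (Suc n))"
      by (rule incseqD[OF inc]) simp
    moreover have "1 / (12 * real (Suc n)) \<ge> 0" "1 / (12 * real (Suc 0)) = 1 / 12" by simp_all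
    ultimately show ?thesis by linarith
  qed
  then have "convergent ?r"
    by (intro Bseq_monoseq_convergent decseq_bounded[of _ "?r 0 - 1 / 12"] decseq_imp_monoseq dec allI)
  then obtain c where "?r \<longlonglongrightarrow> c" by (auto simp: convergent_def)
  then have lim: "stirling_remainder \<longlonglongrightarrow> c" by (rule LIMSEQ_imp_Suc)
  have wallis_ln: "ln (\<Prod>k=1..n. (4 * real k ^ 2) / (4 * real k ^ 2 - 1))
      = 4 * stirling_remainder n - 2 * stirling_remainder (2 * n) - ln 2 - ln (2 + 1 / n)"
    if n: "n > 0" for n
  proof -
    have "ln (2 + 1 / real n) = ln (2 * n + 1) - ln n"
    proof -
      have "2 + 1 / real n = (2 * n + 1) / n" using n by (simp add: field_simps)
      then show ?thesis using n by (simp add: ln_div)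
    qed
    moreover have "ln (16 :: real) = 4 * ln 2" using ln_realpow[of 2 4] by simp
    moreover have "ln (2 * real n) = ln 2 + ln n" using n by (simp add: ln_mult)
    ultimately show ?thesis
      unfolding wallis_product_eq_fact
      using n by (simp add: stirling_remainder_def ln_div ln_mult ln_realpow) (simp add: algebra_simps)
  qed
  have "(\<lambda>n. 4 * stirling_remainder n - 2 * stirling_remainder (2 * n) - ln 2 - ln (2 + 1 / real n))
      \<longlonglongrightarrow> 4 * c - 2 * c - ln 2 - ln (2 + 0)"
    by (intro tendsto_intros lim filterlim_compose[OF lim] lim_1_over_n filterlim_subseq)
       (auto simp: strict_mono_def)
  moreover have "(\<lambda>n. ln (\<Prod>k=1..n. (4 * real k ^ 2) / (4 * real k ^ 2 - 1))) \<longlonglongrightarrow> ln (pi / 2)"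
    by (intro tendsto_ln wallis) auto
  then have "(\<lambda>n. 4 * stirling_remainder n - 2 * stirling_remainder (2 * n) - ln 2 - ln (2 + 1 / real n))
      \<longlonglongrightarrow> ln (pi / 2)"
    by (rule Lim_transform_eventually)
       (use wallis_ln in \<open>auto intro!: eventually_mono[OF eventually_gt_at_top[of "0::nat"]]\<close>)
  ultimately have "4 * c - 2 * c - ln 2 - ln (2 + 0) = ln (pi / 2)" by (rule LIMSEQ_unique)
  then have "c = ln (2 * pi) / 2" by (simp add: ln_div ln_mult)
  with lim show ?thesis by simp
qed

lemma stirling_remainder_bounds:
  assumes "m > 0"
  shows "ln (2 * pi) / 2 \<le> stirling_remainder m"
    and "stirling_remainder m \<le> ln (2 * pi) / 2 + 1 / (12 * real m)"
proof -
  obtain k where k: "m = Suc k" using assms gr0_implies_Suc by blast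
  let ?r = "\<lambda>n. stirling_remainder (Suc n)"
  note dec = decseq_stirling_remainder and inc = incseq_stirling_remainder
  have lim: "?r \<longlonglongrightarrow> ln (2 * pi) / 2"
    using stirling_remainder_LIMSEQ by (rule LIMSEQ_Suc)
  show "ln (2 * pi) / 2 \<le> stirling_remainder m"
    using decseq_ge[OF dec lim, of k] by (simp add: k)
  have "(\<lambda>n. 1 / 12 * (1 / real (Suc n))) \<longlonglongrightarrow> 1 / 12 * 0"
    by (intro tendsto_intros LIMSEQ_Suc lim_1_over_n)
  then have "(\<lambda>n. ?r n - 1 / 12 * (1 / real (Suc n))) \<longlonglongrightarrow> ln (2 * pi) / 2 - 1 / 12 * 0"
    by (intro tendsto_diff lim)
  then have "(\<lambda>n. ?r n - 1 / (12 * real (Suc n))) \<longlonglongrightarrow> ln (2 * pi) / 2"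
    by simp
  from incseq_le[OF inc this, of k]
  show "stirling_remainder m \<le> ln (2 * pi) / 2 + 1 / (12 * real m)" by (simp add: k)
qed

lemma ln_binomial_ge:
  assumes e: "e > 0" and t: "t > 0" and n: "n = e + t"
  shows "n * ln n - e * ln e - t * ln t - ln (2 * pi * e * t / n) / 2 - 1 / (12 * real e) - 1 / (12 * real t)
    \<le> ln (n choose e)"
proof -
  have "real (n choose e) = fact n / (fact e * fact t)"
    using n by (simp add: binomial_fact)
  then have "ln (n choose e) = ln (fact n) - ln (fact e) - ln (fact t)"
    by (simp add: ln_div ln_mult)
  moreover have "ln (fact m) = stirling_remainder m + ((real m + 1 / 2) * ln m - m)" for m
    by (simp add: stirling_remainder_def)
  moreover have "ln (2 * pi * e * t / n) = ln (2 * pi) + ln e + ln t - ln n"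
    using e t n by (simp add: ln_div ln_mult)
  moreover note stirling_remainder_bounds(1)[of n] stirling_remainder_bounds(2)[OF e]
    stirling_remainder_bounds(2)[OF t]
  ultimately show ?thesis using e t by (simp add: n algebra_simps)
qed

section \<open>Hamming balls, the Johnson bound and packing\<close>

lemma card_hamming_sphere:
  "card {x :: 'a::{field,finite} ^ 'n. hamming_weight x = k}
     = (CARD('n) choose k) * (CARD('a) - 1) ^ k"
proof -
  let ?supp = "\<lambda>x :: 'a ^ 'n. {i. x $ i \<noteq> 0}"
  have fiber: "card {x. ?supp x = A} = (CARD('a) - 1) ^ card A" for A
  proof -
    let ?B = "\<lambda>i. if i \<in> A then UNIV - {0 :: 'a} else {0}"
    have "bij_betw vec_lambda (\<Pi>\<^sub>E i\<in>UNIV. ?B i) {x. ?supp x = A}"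
      by (rule bij_betw_byWitness[where f' = vec_nth])
         (auto simp: PiE_iff vec_lambda_inverse split: if_splits)
    then have "card {x. ?supp x = A} = card (\<Pi>\<^sub>E i\<in>UNIV. ?B i)"
      by (simp add: bij_betw_same_card)
    also have "\<dots> = (\<Prod>i\<in>UNIV. card (?B i))" by (simp add: card_PiE)
    also have "\<dots> = (\<Prod>i\<in>A. CARD('a) - 1)"
      by (rule prod.mono_neutral_cong_right) (auto simp: card_Diff_singleton)
    finally show ?thesis by simp
  qed
  have "{x :: 'a ^ 'n. hamming_weight x = k} = (\<Union>A\<in>{A. card A = k}. {x. ?supp x = A})"
    by (auto simp: hamming_weight_def)
  then have "card {x :: 'a ^ 'n. hamming_weight x = k} = (\<Sum>A | card A = k. card {x. ?supp x = A})"
    by (simp only:) (rule card_UN_disjoint; auto)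
  also have "\<dots> = (\<Sum>A :: 'n set | card A = k. (CARD('a) - 1) ^ k)"
    by (intro sum.cong) (auto simp: fiber)
  also have "\<dots> = (CARD('n) choose k) * (CARD('a) - 1) ^ k"
    using n_subsets[of "UNIV :: 'n set" k] by simp
  finally show ?thesis .
qed

lemma card_hamming_ball:
  fixes c :: "'a::{field,finite} ^ 'n"
  shows "card {y. hamming_dist c y \<le> r} = card {x :: 'a ^ 'n. hamming_weight x \<le> r}"
proof -
  have "{x. hamming_weight x \<le> r} = (\<lambda>y. c - y) ` {y. hamming_dist c y \<le> r}"
  proof (intro equalityI subsetI)
    fix x assume "x \<in> {x :: 'a ^ 'n. hamming_weight x \<le> r}"
    then have "c - x \<in> {y. hamming_dist c y \<le> r}" by (simp add: hamming_dist_def)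
    moreover have "x = c - (c - x)" by simp
    ultimately show "x \<in> (\<lambda>y. c - y) ` {y. hamming_dist c y \<le> r}" by (rule rev_image_eqI)
  qed (auto simp: hamming_dist_def)
  moreover have "inj_on (\<lambda>y. c - y) {y. hamming_dist c y \<le> r}" by (auto simp: inj_on_def)
  ultimately show ?thesis by (simp add: card_image)
qed

text \<open>Only the two outermost spheres of the ball are counted. The sphere of radius \<open>e - 1\<close> provides
  the second summand of the last factor; the Stirling estimate of the binomial coefficient alone
  would be too weak when \<open>n - e\<close> is small compared with \<open>sqrt n\<close>.\<close>

lemma card_hamming_ball_ge:
  assumes e: "1 \<le> e" "e < CARD('n)"
  shows "real (CARD('n) choose e) * (real CARD('a) - 1) ^ e
       * (1 + e / ((CARD('n) - e + 1) * (real CARD('a) - 1)))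
     \<le> card {x :: 'a::{field,finite} ^ 'n. hamming_weight x \<le> e}"
proof -
  obtain k where k: "e = Suc k" using e by (cases e) auto
  let ?S = "\<lambda>j. {x :: 'a ^ 'n. hamming_weight x = j}"
  have q: "CARD('a) \<ge> 2"
    using card_mono[of "UNIV :: 'a set" "{0, 1}"] by simp
  have "card (?S e) + card (?S k) = card (?S e \<union> ?S k)"
    by (rule card_Un_disjoint[symmetric]) (auto simp: k)
  also have "\<dots> \<le> card {x :: 'a ^ 'n. hamming_weight x \<le> e}"
    by (rule card_mono) (auto simp: k)
  finally have le: "real (card (?S e)) + card (?S k) \<le> card {x :: 'a ^ 'n. hamming_weight x \<le> e}"
    by (metis of_nat_add of_nat_le_iff)
  let ?p = "real CARD('a) - 1"
  have p: "?p > 0" using q by simp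
  have "real e * (CARD('n) choose e) = (CARD('n) - e + 1) * (CARD('n) choose k)"
  proof -
    have "e * (CARD('n) choose e) = (CARD('n) - k) * (CARD('n) choose k)"
      using binomial_absorption[of k "CARD('n)"] binomial_absorb_comp[of "CARD('n)" k] by (simp add: k)
    moreover have "CARD('n) - k = CARD('n) - e + 1" using e by (simp add: k)
    ultimately show ?thesis by (metis of_nat_mult)
  qed
  then have "real (CARD('n) choose e) * ?p ^ e * (e / ((CARD('n) - e + 1) * ?p))
      = (CARD('n) choose k) * ?p ^ k"
    using p by (simp add: k divide_simps) (simp add: algebra_simps)
  moreover have "real (card (?S e)) = (CARD('n) choose e) * ?p ^ e"
    and "real (card (?S k)) = (CARD('n) choose k) * ?p ^ k"
    using q by (simp_all add: card_hamming_sphere of_nat_diff)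
  ultimately show ?thesis using le by (simp add: distrib_left)
qed

text \<open>The pairs that agree at \<open>i\<close> number \<open>\<Sum>a. m(a)^2\<close>, where \<open>m(a)\<close> counts the words with entry
  \<open>a\<close> there. With the share of \<open>y\<close> known, this sum is smallest when the words that
  differ from \<open>y\<close> are spread evenly over the \<open>q - 1\<close> remaining symbols.\<close>

lemma coordinate_disagreements_le:
  fixes S :: "('a::{field,finite} ^ 'n) set"
  shows "real (card {p \<in> S \<times> S. fst p $ i \<noteq> snd p $ i}) * (real CARD('a) - 1)
    \<le> 2 * (real CARD('a) - 1) * card S * card {c \<in> S. c $ i \<noteq> y}
      - CARD('a) * (card {c \<in> S. c $ i \<noteq> y})\<^sup>2"
proof -
  let ?q = "real CARD('a)"
  define m where "m a = real (card {c \<in> S. c $ i = a})" for a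
  define w where "w = real (card {c \<in> S. c $ i \<noteq> y})"
  have total: "(\<Sum>a\<in>A. m a) = card {c \<in> S. c $ i \<in> A}" for A
  proof -
    have "{c \<in> S. c $ i \<in> A} = (\<Union>a\<in>A. {c \<in> S. c $ i = a})" by auto
    then have "card {c \<in> S. c $ i \<in> A} = (\<Sum>a\<in>A. card {c \<in> S. c $ i = a})"
      by (simp only:) (rule card_UN_disjoint; auto)
    then show ?thesis by (simp add: m_def)
  qed
  have agree: "real (card {p \<in> S \<times> S. fst p $ i = snd p $ i}) = (\<Sum>a\<in>UNIV. (m a)\<^sup>2)"
  proof -
    have "{p \<in> S \<times> S. fst p $ i = snd p $ i}
        = (\<Union>a\<in>UNIV. {c \<in> S. c $ i = a} \<times> {c \<in> S. c $ i = a})" by auto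
    then have "card {p \<in> S \<times> S. fst p $ i = snd p $ i}
        = (\<Sum>a\<in>UNIV. card ({c \<in> S. c $ i = a} \<times> {c \<in> S. c $ i = a}))"
      by (simp only:) (rule card_UN_disjoint; auto)
    then show ?thesis by (simp add: m_def power2_eq_square card_cartesian_product)
  qed
  have w: "(\<Sum>a\<in>UNIV - {y}. m a) = w" by (simp add: total w_def)
  have my: "m y = card S - w"
    using total[of UNIV] w by (simp add: sum.remove[of UNIV y])
  have spread: "w\<^sup>2 \<le> (\<Sum>a\<in>UNIV - {y}. (m a)\<^sup>2) * (?q - 1)"
    using sum_squared_le_sum_of_squares[of m "UNIV - {y}"] w
    by (simp add: card_Diff_singleton of_nat_diff Suc_leI)
  have "(\<Sum>a\<in>UNIV. (m a)\<^sup>2) = (m y)\<^sup>2 + (\<Sum>a\<in>UNIV - {y}. (m a)\<^sup>2)"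
    by (simp add: sum.remove[of UNIV y])
  moreover have "real (card {p \<in> S \<times> S. fst p $ i \<noteq> snd p $ i}) = (card S)\<^sup>2 - (\<Sum>a\<in>UNIV. (m a)\<^sup>2)"
  proof -
    have "card (S \<times> S) = card ({p \<in> S \<times> S. fst p $ i \<noteq> snd p $ i} \<union> {p \<in> S \<times> S. fst p $ i = snd p $ i})"
      by (rule arg_cong[of _ _ card]) auto
    also have "\<dots> = card {p \<in> S \<times> S. fst p $ i \<noteq> snd p $ i} + card {p \<in> S \<times> S. fst p $ i = snd p $ i}"
      by (rule card_Un_disjoint) auto
    finally have "real (card S * card S) = card {p \<in> S \<times> S. fst p $ i \<noteq> snd p $ i}
        + card {p \<in> S \<times> S. fst p $ i = snd p $ i}"
      by (simp add: card_cartesian_product)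
    then show ?thesis using agree by (simp add: power2_eq_square)
  qed
  ultimately have "real (card {p \<in> S \<times> S. fst p $ i \<noteq> snd p $ i}) * (?q - 1)
      = ((card S)\<^sup>2 - (card S - w)\<^sup>2) * (?q - 1) - (\<Sum>a\<in>UNIV - {y}. (m a)\<^sup>2) * (?q - 1)"
    by (simp only: my left_diff_distrib) (simp add: algebra_simps)
  also have "\<dots> \<le> ((card S)\<^sup>2 - (card S - w)\<^sup>2) * (?q - 1) - w\<^sup>2"
    using spread by (intro diff_left_mono)
  also have "\<dots> = 2 * (?q - 1) * card S * w - ?q * w\<^sup>2"
    by (simp add: algebra_simps power2_eq_square)
  finally show ?thesis by (simp add: w_def)
qed

text \<open>The Johnson bound by counting pairs. Let \<open>W\<close> be the sum of the distances to \<open>y\<close> over the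
  \<open>L\<close> words in the list. The sum of all pairwise distances is at least \<open>L * (L - 1) * d\<close>. Adding the
  coordinatewise bound and applying Cauchy--Schwarz over the coordinates, it is at most
  \<open>2 * L * W - q / (q - 1) * W^2 / n\<close>. This quadratic increases for \<open>W \<le> L * n * (q - 1) / q\<close>,
  so \<open>W\<close> may be replaced by \<open>L * e\<close>, and \<open>L\<close> cancels.\<close>

lemma johnson_list_bound:
  fixes S :: "('a::{field,finite} ^ 'n) set" and y :: "'a ^ 'n"
    and q n :: real
  defines "q \<equiv> real CARD('a)" and "n \<equiv> real CARD('n)"
  assumes dist: "\<And>c c'. c \<in> S \<Longrightarrow> c' \<in> S \<Longrightarrow> c \<noteq> c' \<Longrightarrow> d \<le> hamming_dist c c'"
    and ball: "\<And>c. c \<in> S \<Longrightarrow> hamming_dist c y \<le> e"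
    and e: "q * e \<le> (q - 1) * n"
  shows "card S * (q * e\<^sup>2 - 2 * (q - 1) * n * e + (q - 1) * n * d) \<le> (q - 1) * n * d"
proof (cases "S = {}")
  case False
  define L where "L = real (card S)"
  have L: "L \<ge> 1" using False by (simp add: L_def Suc_le_eq card_gt_0_iff)
  have q: "q \<ge> 1" by (simp add: q_def Suc_le_eq)
  have n: "n > 0" by (simp add: n_def)
  define w where "w i = real (card {c \<in> S. c $ i \<noteq> y $ i})" for i
  define W where "W = (\<Sum>i\<in>UNIV. w i)"
  have swap: "(\<Sum>i\<in>UNIV. card {p \<in> T. f p $ i \<noteq> g p $ i}) = (\<Sum>p\<in>T. hamming_dist (f p) (g p))"
    if "finite T" for T :: "'b set" and f g :: "'b \<Rightarrow> 'a ^ 'n"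
  proof -
    have "(\<Sum>i\<in>UNIV. card {p \<in> T. f p $ i \<noteq> g p $ i})
        = (\<Sum>i\<in>UNIV. \<Sum>p\<in>T. if f p $ i \<noteq> g p $ i then 1 else 0)"
      using that by (simp add: sum.If_cases Int_def)
    also have "\<dots> = (\<Sum>p\<in>T. \<Sum>i\<in>UNIV. if f p $ i \<noteq> g p $ i then 1 else 0)"
      by (rule sum.swap)
    also have "\<dots> = (\<Sum>p\<in>T. hamming_dist (f p) (g p))"
      by (simp add: sum.If_cases hamming_dist_def hamming_weight_def)
    finally show ?thesis .
  qed
  have "(\<Sum>c\<in>S. hamming_dist c y) \<le> card S * e"
    using sum_bounded_above[of S "\<lambda>c. hamming_dist c y" e] ball by simp
  moreover have "W = real (\<Sum>c\<in>S. hamming_dist c y)"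
    unfolding W_def w_def using swap[of S "\<lambda>c. c" "\<lambda>_. y"] by (simp flip: of_nat_sum)
  ultimately have W: "W \<le> L * e" unfolding L_def by (metis of_nat_le_iff of_nat_mult)
  let ?P = "{p \<in> S \<times> S. fst p \<noteq> snd p}"
  have "card (S \<times> S) = card (?P \<union> (\<lambda>c. (c, c)) ` S)" by (rule arg_cong[of _ _ card]) auto
  also have "\<dots> = card ?P + card ((\<lambda>c. (c, c)) ` S)" by (rule card_Un_disjoint) auto
  also have "card ((\<lambda>c. (c, c)) ` S) = card S" by (rule card_image) (auto simp: inj_on_def)
  finally have P: "real (card ?P) = L * (L - 1)"
    by (simp add: L_def card_cartesian_product algebra_simps flip: of_nat_mult of_nat_add)
  have "L * (L - 1) * d = real (\<Sum>p\<in>?P. d)" by (simp add: P)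
  also have "\<dots> \<le> real (\<Sum>p\<in>?P. hamming_dist (fst p) (snd p))"
    by (intro of_nat_mono sum_mono dist) auto
  also have "\<dots> \<le> real (\<Sum>p\<in>S \<times> S. hamming_dist (fst p) (snd p))"
    by (intro of_nat_mono sum_mono2) auto
  also have "\<dots> = (\<Sum>i\<in>UNIV. real (card {p \<in> S \<times> S. fst p $ i \<noteq> snd p $ i}))"
    using swap[of "S \<times> S" fst snd] by (simp flip: of_nat_sum)
  finally have "L * (L - 1) * d * (q - 1)
      \<le> (\<Sum>i\<in>UNIV. real (card {p \<in> S \<times> S. fst p $ i \<noteq> snd p $ i})) * (q - 1)"
    using q by (intro mult_right_mono) auto
  also have "\<dots> \<le> (\<Sum>i\<in>UNIV. 2 * (q - 1) * L * w i - q * (w i)\<^sup>2)"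
    unfolding sum_distrib_right
    using coordinate_disagreements_le[of S _ "y $ _"] by (intro sum_mono) (auto simp: q_def L_def w_def)
  also have "\<dots> = 2 * (q - 1) * L * W - q * (\<Sum>i\<in>UNIV. (w i)\<^sup>2)"
    by (simp add: sum_subtractf sum_distrib_left W_def)
  finally have "L * (L - 1) * d * (q - 1) \<le> 2 * (q - 1) * L * W - q * (\<Sum>i\<in>UNIV. (w i)\<^sup>2)" .
  then have "n * (L * (L - 1) * d * (q - 1))
      \<le> n * (2 * (q - 1) * L * W - q * (\<Sum>i\<in>UNIV. (w i)\<^sup>2))"
    using n by (intro mult_left_mono) auto
  also have "\<dots> = 2 * (q - 1) * n * L * W - q * ((\<Sum>i\<in>UNIV. (w i)\<^sup>2) * n)"
    by (simp add: algebra_simps)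
  also have "\<dots> \<le> 2 * (q - 1) * n * L * W - q * W\<^sup>2"
    using sum_squared_le_sum_of_squares[of w UNIV] q
    by (intro diff_left_mono mult_left_mono) (auto simp: W_def n_def)
  also have "\<dots> \<le> 2 * (q - 1) * n * L * (L * e) - q * (L * e)\<^sup>2"
  proof -
    have "q * (L * e + W) \<le> q * (L * e + L * e)" using W q by (intro mult_left_mono) auto
    also have "\<dots> = 2 * L * (q * e)" by simp
    also have "\<dots> \<le> 2 * L * ((q - 1) * n)" using e L by (intro mult_left_mono) auto
    also have "\<dots> = 2 * (q - 1) * n * L" by simp
    finally have "0 \<le> (L * e - W) * (2 * (q - 1) * n * L - q * (L * e + W))"
      using W by (intro mult_nonneg_nonneg) auto
    then show ?thesis by (simp add: algebra_simps power2_eq_square)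
  qed
  finally have "L * (n * ((L - 1) * d * (q - 1))) \<le> L * (L * (2 * (q - 1) * n * e - q * e\<^sup>2))"
    by (simp add: algebra_simps power2_eq_square)
  then have "n * ((L - 1) * d * (q - 1)) \<le> L * (2 * (q - 1) * n * e - q * e\<^sup>2)"
    using L by simp
  then show ?thesis by (simp add: L_def algebra_simps)
qed (use assms in \<open>simp add: q_def n_def Suc_le_eq\<close>)

text \<open>Count the pairs of a codeword and a word at distance at most \<open>e\<close> from it: every codeword
  sees a whole ball, and by the Johnson bound no word is seen by many codewords.\<close>

lemma packing_bound:
  fixes C :: "('a::{field,finite} ^ 'n) set"
    and q n D :: real
  defines "q \<equiv> real CARD('a)" and "n \<equiv> real CARD('n)"
  assumes dist: "\<And>c c'. c \<in> C \<Longrightarrow> c' \<in> C \<Longrightarrow> c \<noteq> c' \<Longrightarrow> d \<le> hamming_dist c c'"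
    and e: "q * e \<le> (q - 1) * n"
    and D: "D = q * e\<^sup>2 - 2 * (q - 1) * n * e + (q - 1) * n * d" "D \<ge> 0"
  shows "card C * card {x :: 'a ^ 'n. hamming_weight x \<le> e} * D \<le> q ^ CARD('n) * ((q - 1) * n * d)"
proof -
  have "card C * card {x :: 'a ^ 'n. hamming_weight x \<le> e}
      = (\<Sum>c\<in>C. card {y \<in> UNIV. hamming_dist c y \<le> e})"
    by (simp add: card_hamming_ball)
  also have "\<dots> = (\<Sum>y\<in>UNIV. card {c \<in> C. hamming_dist c y \<le> e})"
    using sum.swap_restrict[of C "UNIV :: ('a ^ 'n) set" "\<lambda>_ _. 1 :: nat" "\<lambda>c y. hamming_dist c y \<le> e"]
    by simp
  finally have "real (card C * card {x :: 'a ^ 'n. hamming_weight x \<le> e}) * D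
      = (\<Sum>y\<in>UNIV. card {c \<in> C. hamming_dist c y \<le> e} * D)"
    by (simp add: sum_distrib_right)
  also have "\<dots> \<le> (\<Sum>y\<in>(UNIV :: ('a ^ 'n) set). (q - 1) * n * d)"
    unfolding D(1) q_def n_def
    by (intro sum_mono johnson_list_bound) (use dist e in \<open>auto simp: q_def n_def\<close>)
  also have "\<dots> = q ^ CARD('n) * ((q - 1) * n * d)"
    by (simp add: q_def)
  finally show ?thesis by simp
qed

section \<open>Absorbing the difference between the error terms\<close>

lemma stirling_gap_le:
  assumes "m \<ge> (1 :: nat)"
  shows "1 / (12 * real m) - 1 / (12 * real m + 1) \<le> 1 / (144 * (real m)\<^sup>2)"
    and "1 / (12 * real m) - 1 / (12 * real m + 1) \<le> 1 / 156"
proof -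
  have gap: "1 / (12 * real m) - 1 / (12 * real m + 1) = 1 / (12 * real m * (12 * real m + 1))"
    using assms by (simp add: divide_simps)
  show "1 / (12 * real m) - 1 / (12 * real m + 1) \<le> 1 / (144 * (real m)\<^sup>2)"
    unfolding gap using assms
    by (intro divide_left_mono) (auto simp: algebra_simps power2_eq_square intro!: add_pos_pos)
  have "12 * 13 \<le> 12 * real m * (12 * real m + 1)"
    using assms by (intro mult_mono) auto
  then show "1 / (12 * real m) - 1 / (12 * real m + 1) \<le> 1 / 156"
    unfolding gap using assms by (intro divide_left_mono) auto
qed

text \<open>Stirling's formula with remainder bounds yields \<open>1/(12*e) + 1/(12*t)\<close>, where \<open>t = n - e\<close>,
  and this lemma pays for lowering both terms to \<open>1/(12*e + 1)\<close> and \<open>1/(12*t + 1)\<close>. Three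
  savings are available: the integer \<open>D\<close> and the factor \<open>q / (q - 1)\<close> from the Johnson bound, and the
  second sphere of the Hamming ball.

  If \<open>D \<ge> 2\<close>, the saving \<open>ln 2\<close> is ample. If \<open>D = 1\<close>, then \<open>D \<equiv> e^2\<close> modulo \<open>q - 1\<close> makes
  \<open>q - 1\<close> a divisor of \<open>e^2 - 1\<close>. Here \<open>e = 1\<close> would force \<open>n\<close> to divide \<open>1\<close>, so \<open>e^2 \<ge> q\<close>, and
  the term for \<open>e\<close>, at most \<open>1/(144*e^2)\<close>, is absorbed by \<open>ln (q/(q-1)) \<ge> 1/q\<close>. The term for
  \<open>t\<close> is absorbed by \<open>1/(12*n)\<close> if \<open>12 * t^2 \<ge> n\<close>. Otherwise \<open>t\<close> is much smaller than \<open>n\<close>, and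
  \<open>D > 0\<close> together with \<open>d < n\<close> bounds \<open>q\<close> by about \<open>n\<close>, so that the second sphere increases
  the ball by a factor of at least \<open>1 + 1/(4*t)\<close>.\<close>

lemma stirling_gap_absorbed:
  fixes q n d e t :: nat
  defines "D \<equiv> int q * (int e)\<^sup>2 - 2 * (int q - 1) * int n * int e + (int q - 1) * int n * int d"
  assumes q: "q \<ge> 2" and e: "e \<ge> 1" and t: "t \<ge> 1" and n: "n = e + t" and d: "d < n" and D: "D \<ge> 1"
  shows "(1 / (12 * real e) - 1 / (12 * real e + 1)) + (1 / (12 * real t) - 1 / (12 * real t + 1))
    \<le> 1 / (12 * real n) + ln (D * (q / (real q - 1))) + ln (1 + e / ((t + 1) * (real q - 1)))"
    (is "?ge + ?gt \<le> _ + ln (_ * ?u) + ln (1 + ?x)")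
proof -
  have q1: "real q - 1 \<ge> 1" using q by simp
  have u: "?u > 1" using q1 by (simp add: field_simps)
  have x: "?x \<ge> 0" using q1 by simp
  then have lnx: "ln (1 + ?x) \<ge> 0" by simp
  have D_alt: "D = (int e)\<^sup>2 + (int q - 1) * ((int t)\<^sup>2 - (int n)\<^sup>2 + int n * int d)"
    unfolding D_def n by (simp add: algebra_simps power2_eq_square)
  consider (large) "D \<ge> 2" | (one) "D = 1" using D by linarith
  then show ?thesis
  proof cases
    case large
    \<comment> \<open>The two gaps sum to at most \<open>1/78\<close>; the crude bound \<open>1/2 \<le> ln 2\<close> is enough.\<close>
    have "exp (1 / 2 :: real) \<le> 2"
    proof -
      have "exp (1 / 2 :: real) * exp (1 / 2) = exp 1" by (simp flip: exp_add)
      also have "\<dots> \<le> 2 * 2" using exp_le by simp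
      finally show ?thesis
        using mult_strict_mono[of 2 "exp (1 / 2 :: real)" 2 "exp (1 / 2)"] by force
    qed
    moreover have "2 * 1 \<le> real_of_int D * ?u" using large u by (intro mult_mono) auto
    ultimately have "1 / 2 \<le> ln (D * ?u)" by (subst ln_ge_iff) auto
    moreover have "?ge + ?gt \<le> 1 / 156 + 1 / 156"
      using stirling_gap_le(2)[OF e] stirling_gap_le(2)[OF t] by linarith
    moreover have "1 / (12 * real n) \<ge> 0" by simp
    ultimately show ?thesis using lnx by linarith
  next
    case one
    have lnu: "1 / q \<le> ln ?u"
    proof -
      have "ln (1 / ?u) \<le> 1 / ?u - 1" using u q1 q by (intro ln_le_minus_one) auto
      moreover have "1 / ?u - 1 = - (1 / q)" using q1 by (simp add: field_simps)
      moreover have "ln (1 / ?u) = - ln ?u" using u by (simp add: ln_div)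
      ultimately show ?thesis by linarith
    qed
    have "int e \<noteq> 1"
    proof
      assume "int e = 1"
      with one have "(int q - 1) * ((int t)\<^sup>2 - (int n)\<^sup>2 + int n * int d) = 0" by (simp add: D_alt)
      with q have "(int t)\<^sup>2 - (int n)\<^sup>2 + int n * int d = 0" by simp
      with \<open>int e = 1\<close> have "int n * (2 - int d) = 1"
        by (simp add: n algebra_simps power2_eq_square)
      then have "int n dvd 1" by (metis dvd_triv_left)
      with e t n show False by simp
    qed
    with e have "int e \<ge> 2" by simp
    have "int q - 1 dvd (int e)\<^sup>2 - 1"
    proof -
      have "(int e)\<^sup>2 - 1 = (int q - 1) * - ((int t)\<^sup>2 - (int n)\<^sup>2 + int n * int d)"
        using one unfolding D_alt mult_minus_right by linarith
      then show ?thesis by simp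
    qed
    moreover have "(int e)\<^sup>2 - 1 > 0" using power_mono[OF \<open>int e \<ge> 2\<close>, of 2] by simp
    ultimately have "int q - 1 \<le> (int e)\<^sup>2 - 1" by (rule zdvd_imp_le)
    then have "int q \<le> int (e\<^sup>2)" unfolding of_nat_power by linarith
    then have "real q \<le> real (e\<^sup>2)" by (simp only: of_nat_le_iff)
    then have "real q \<le> (real e)\<^sup>2" by simp
    then have "real q \<le> 144 * (real e)\<^sup>2" using zero_le_power2[of "real e"] by linarith
    then have "1 / (144 * (real e)\<^sup>2) \<le> 1 / q" by (rule frac_le[rotated -1]) (use q in auto)
    then have ge: "?ge \<le> ln (D * ?u)" using stirling_gap_le(1)[OF e] lnu one by simp
    have "?gt \<le> 1 / (12 * real n) + ln (1 + ?x)"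
    proof (cases "n \<le> 12 * t\<^sup>2")
      case True
      then have "real n \<le> real (12 * t\<^sup>2)" by (simp only: of_nat_le_iff)
      then have "real n \<le> 12 * (real t)\<^sup>2" by simp
      then have "12 * real n \<le> 144 * (real t)\<^sup>2" by linarith
      then have "1 / (144 * (real t)\<^sup>2) \<le> 1 / (12 * real n)"
        by (rule frac_le[rotated -1]) (use n e in auto)
      then show ?thesis using stirling_gap_le(1)[OF t] lnx by linarith
    next
      case False
      then have "real (12 * t\<^sup>2) < real n" by (simp only: of_nat_less_iff not_le)
      then have t2: "12 * (real t)\<^sup>2 < real n" by simp
      \<comment> \<open>From \<open>12 * t \<le> 12 * t^2 < n\<close> almost all of \<open>n\<close> is \<open>e\<close>.\<close>
      have "real t \<le> (real t)\<^sup>2" using t by (simp add: power2_eq_square)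
      moreover have nsum: "real n = real e + real t" using n by simp
      ultimately have te: "11 * real n < 12 * real e" using t2 by linarith
      have "(real q - 1) * (real n - (real t)\<^sup>2) < (real n)\<^sup>2"
      proof -
        have "n * d + n \<le> n\<^sup>2" using d mult_le_mono2[of "Suc d" n n] by (simp add: power2_eq_square)
        then have "real (n * d + n) \<le> real (n\<^sup>2)" by (simp only: of_nat_le_iff)
        then have "real n * d + n \<le> (real n)\<^sup>2" by simp
        then have "(real q - 1) * (real n - (real t)\<^sup>2)
            \<le> (real q - 1) * - ((real t)\<^sup>2 - (real n)\<^sup>2 + real n * d)"
          using q1 by (intro mult_left_mono) linarith+
        also have "\<dots> = (real e)\<^sup>2 - real_of_int D" by (simp add: D_alt algebra_simps)
        also have "\<dots> < (real e)\<^sup>2" using one by simp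
        also have "\<dots> \<le> (real n)\<^sup>2" using n by (intro power_mono) auto
        finally show ?thesis .
      qed
      moreover have "(real q - 1) * (11 / 12 * n) \<le> (real q - 1) * (real n - (real t)\<^sup>2)"
        using q1 t2 by (intro mult_left_mono) linarith+
      moreover have "(real q - 1) * (11 / 12 * n) = n * ((real q - 1) * (11 / 12))"
        "(real n)\<^sup>2 = n * real n"
        by (simp_all add: power2_eq_square)
      ultimately have "n * ((real q - 1) * (11 / 12)) < n * real n" by linarith
      then have qn: "(real q - 1) * (11 / 12) < n" by (rule mult_left_less_imp_less) simp
      have "1 / (4 * t) \<le> ?x"
      proof -
        have "(t + 1) * (real q - 1) \<le> (2 * real t) * (12 / 11 * n)"
          using t qn q1 by (intro mult_mono) auto
        also have "\<dots> \<le> (2 * real t) * (2 * e)"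
          using te by (intro mult_left_mono) linarith+
        finally show ?thesis using t q1 by (simp add: divide_simps) (simp add: algebra_simps)
      qed
      then have "ln (1 + 1 / (4 * t)) \<le> ln (1 + ?x)"
        by (intro ln_mono) (auto intro: add_pos_nonneg)
      moreover have "1 / (4 * real t + 1) \<le> ln (1 + 1 / (4 * t))"
      proof -
        have "1 / (4 * real t + 1) = 1 / (4 * t) / (1 + 1 / (4 * t))"
          using t by (simp add: divide_simps)
        also have "\<dots> \<le> ln (1 / (4 * t) + 1)" by (rule ln_add1_ge) simp
        finally show ?thesis by (simp add: add.commute)
      qed
      moreover have "4 * real t + 1 \<le> 144 * (real t)\<^sup>2"
        using t \<open>real t \<le> (real t)\<^sup>2\<close> by linarith
      then have "1 / (144 * (real t)\<^sup>2) \<le> 1 / (4 * real t + 1)"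
        by (rule frac_le[rotated -1]) auto
      moreover have "1 / (12 * real n) \<ge> 0" by simp
      ultimately show ?thesis using stirling_gap_le(1)[OF t] by linarith
    qed
    with ge show ?thesis by linarith
  qed
qed

section \<open>The rate bound at the Johnson radius\<close>

text \<open>The number \<open>n * J(\<delta>)\<close> is the smaller root of the quadratic polynomial in \<open>e\<close> below. Its
  coefficients are integers when \<open>n * \<delta>\<close> is one, so that at an integer \<open>e\<close> below the root its value
  is not merely positive but at least \<open>1\<close>.\<close>

lemma johnson_radius_condition:
  fixes q :: nat and n e \<delta> :: real
  assumes q: "q \<ge> 2" and n: "n > 0" and \<delta>: "\<delta> \<le> 1 - 1 / q" and e: "e < n * johnson_radius q \<delta>"
  shows "q * e < (q - 1) * n"
    and "0 < q * e\<^sup>2 - 2 * (real q - 1) * n * e + (real q - 1) * n * (n * \<delta>)"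
proof -
  define \<theta> where "\<theta> = 1 - 1 / real q"
  \<comment> \<open>The polynomial is \<open>q\<close> times \<open>(n * \<theta> - e)^2 - (n * \<theta> * s)^2\<close>.\<close>
  define s where "s = sqrt (1 - \<delta> / \<theta>)"
  have \<theta>: "\<theta> > 0" "q * \<theta> = real q - 1" using q by (auto simp: \<theta>_def field_simps)
  have J: "johnson_radius q \<delta> = \<theta> * (1 - s)"
  proof -
    have "real q / (real q - 1) * \<delta> = \<delta> / \<theta>" using q by (simp add: \<theta>_def field_simps)
    then show ?thesis by (simp add: johnson_radius_def \<theta>_def s_def)
  qed
  have "\<delta> / \<theta> \<le> 1" using \<delta> \<theta> by (simp add: \<theta>_def)
  then have s: "s \<ge> 0" "s\<^sup>2 = 1 - \<delta> / \<theta>" by (auto simp: s_def)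
  have less: "n * \<theta> * s < n * \<theta> - e" using e by (simp add: J algebra_simps)
  have nonneg: "n * \<theta> * s \<ge> 0" using n \<theta> s by simp
  have "q * e < q * (n * \<theta>)" using less nonneg q by (intro mult_strict_left_mono) auto
  also have "\<dots> = (q * \<theta>) * n" by simp
  also have "\<dots> = (q - 1) * n" using \<theta> q by (simp add: of_nat_diff)
  finally show "q * e < (q - 1) * n" .
  have "(n * \<theta> * s)\<^sup>2 < (n * \<theta> - e)\<^sup>2" by (rule power_strict_mono[OF less nonneg]) simp
  also have "(n * \<theta> * s)\<^sup>2 = (n * \<theta>)\<^sup>2 - n * \<theta> * (n * \<delta>)"
    unfolding power_mult_distrib s(2) using \<theta>(1) by (simp add: field_simps power2_eq_square)
  finally have "0 < e\<^sup>2 - 2 * n * \<theta> * e + n * \<theta> * (n * \<delta>)"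
    by (simp add: algebra_simps power2_eq_square)
  then have "0 < q * (e\<^sup>2 - 2 * n * \<theta> * e + n * \<theta> * (n * \<delta>))"
    using q by simp
  also have "\<dots> = q * e\<^sup>2 - 2 * (q * \<theta>) * n * e + (q * \<theta>) * n * (n * \<delta>)"
    by (simp add: algebra_simps)
  finally show "0 < q * e\<^sup>2 - 2 * (real q - 1) * n * e + (real q - 1) * n * (n * \<delta>)"
    unfolding \<theta>(2) .
qed

lemma hamming_dist_ge_min_distance:
  "c \<in> C \<Longrightarrow> c' \<in> C \<Longrightarrow> c \<noteq> c' \<Longrightarrow> min_distance C \<le> hamming_dist c c'"
  unfolding min_distance_def by (rule wellorder_Inf_le1) blast

text \<open>The code enters through a lower bound for its pairwise distances, which a one-word code satisfies for
  every \<open>d\<close>; in this form the bound also covers codes without two distinct words.\<close>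

lemma code_rate_le_johnson_stirling:
  fixes C :: "('a::{field,finite} ^ 'n) set" and q n d e :: nat
  assumes q: "q = CARD('a)" and n: "n = CARD('n)"
    and C: "C \<noteq> {}"
    and dist: "\<And>c c'. c \<in> C \<Longrightarrow> c' \<in> C \<Longrightarrow> c \<noteq> c' \<Longrightarrow> d \<le> hamming_dist c c'"
    and "d \<ge> 1" "d < n" and e: "e \<ge> 1" "q * e < (q - 1) * n"
    and D: "0 < q * (real e)\<^sup>2 - 2 * (real q - 1) * n * e + (real q - 1) * n * d"
  shows "code_rate C \<le> 1 - q_entropy q (e / n)
      + 1 / (2 * n) * log q (2 * pi * (e / n) * (1 - e / n) * n)
      + 1 / n * log q (real q * n * d)
      + 1 / (n * ln q) * (1 / (12 * n) + 1 / (12 * real e + 1) + 1 / (12 * (real n - e) + 1))"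
proof -
  have q2: "q \<ge> 2"
    unfolding q using card_mono[of "UNIV :: 'a set" "{0, 1}"] by simp
  have "q * e < q * n" using e(2) mult_le_mono1[of "q - 1" q n] by linarith
  then have "e < n" by simp
  then obtain t where t: "n = e + t" "t \<ge> 1" using less_imp_add_positive[of e n] by auto
  let ?p = "real q - 1"
  let ?x = "e / ((t + 1) * ?p)"
  let ?V = "card {x :: 'a ^ 'n. hamming_weight x \<le> e}"
  define D where "D = int q * (int e)\<^sup>2 - 2 * (int q - 1) * int n * int e + (int q - 1) * int n * int d"
  have D_real: "real_of_int D = q * (real e)\<^sup>2 - 2 * ?p * n * e + ?p * n * d"
    by (simp add: D_def)
  have D1: "D \<ge> 1" using D unfolding D_real[symmetric] by simp
  have p: "?p > 0" using q2 by simp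
  have "card C > 0" using C by (simp add: card_gt_0_iff)
  have V: "real (n choose e) * ?p ^ e * (1 + ?x) \<le> ?V"
    using card_hamming_ball_ge[where 'a = 'a and 'n = 'n, of e] e \<open>e < n\<close> t(1) by (simp add: q n)
  have x: "1 + ?x > 0" using p by (intro add_pos_nonneg) auto
  have lower: "real (n choose e) * ?p ^ e * (1 + ?x) > 0"
    using p x \<open>e < n\<close> by simp
  have "real (q * e) \<le> real ((q - 1) * n)" using e(2) by (simp only: of_nat_le_iff)
  then have pack: "real (card C * ?V) * D \<le> real q ^ n * (?p * n * d)"
    using packing_bound[of C d e D] dist D1 D_real q2
    by (simp add: q n of_nat_diff)
  have "card C * (real (n choose e) * ?p ^ e * (1 + ?x)) * D \<le> real (card C * ?V) * D"
    using V D1 by (auto intro!: mult_right_mono mult_left_mono)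
  with pack have "card C * (real (n choose e) * ?p ^ e * (1 + ?x)) * D \<le> real q ^ n * (?p * n * d)"
    by linarith
  moreover have "0 < card C * (real (n choose e) * ?p ^ e * (1 + ?x)) * D"
    using \<open>card C > 0\<close> lower D1 by simp
  ultimately have "ln (card C * (real (n choose e) * ?p ^ e * (1 + ?x)) * D) \<le> ln (real q ^ n * (?p * n * d))"
    by (intro ln_mono)
  moreover have "ln (card C * (real (n choose e) * ?p ^ e * (1 + ?x)) * D)
      = ln (card C) + ln (n choose e) + e * ln ?p + ln (1 + ?x) + ln D"
    using \<open>card C > 0\<close> p x D1 \<open>e < n\<close> by (simp add: ln_mult_pos ln_realpow)
  moreover have "ln (real q ^ n * (?p * n * d)) = n * ln q + ln (real q * n * d) + ln ?p - ln q"
    using p q2 \<open>d \<ge> 1\<close> \<open>e < n\<close> by (simp add: ln_mult_pos ln_realpow)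
  moreover have "ln (D * (q / ?p)) = ln D + ln q - ln ?p"
    using p q2 D1 by (simp add: ln_mult_pos ln_div)
  moreover note ln_binomial_ge[of e t n]
    stirling_gap_absorbed[of q e t n d, folded D_def]
  ultimately have main: "ln (card C) \<le> n * ln q - (e * ln ?p + n * ln n - e * ln e - t * ln t)
      + ln (2 * pi * e * t / n) / 2 + ln (real q * n * d)
      + (1 / (12 * real n) + 1 / (12 * real e + 1) + 1 / (12 * real t + 1))"
    using q2 e t D1 \<open>d < n\<close> by simp
  have n0: "real n > 0" and lnq: "ln q > 0" and t0: "real t > 0" and e0: "real e > 0"
    using \<open>e < n\<close> q2 t e by auto
  have nt: "real n - e = t" and frac: "1 - e / n = t / n" using t(1) n0 by (simp_all add: field_simps)
  have entropy: "q_entropy q (e / n) * (n * ln q) = e * ln ?p + n * ln n - e * ln e - t * ln t"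
  proof -
    have "q_entropy q (e / n) * (n * ln q)
        = (e / n) * n * ln ?p - (e / n) * n * ln (e / n) - (t / n) * n * ln (t / n)"
      unfolding q_entropy_def frac log_def using lnq by (simp add: field_simps)
    also have "\<dots> = e * ln ?p - e * ln (e / n) - t * ln (t / n)" using n0 by simp
    also have "\<dots> = e * ln ?p + n * ln n - e * ln e - t * ln t"
      using n0 e0 t0 by (simp add: ln_div t(1) algebra_simps)
    finally show ?thesis .
  qed
  have prod: "2 * pi * (e / n) * (1 - e / n) * n = 2 * pi * e * t / n"
    unfolding frac using n0 by simp
  define B where "B = 1 - q_entropy q (e / n)
      + 1 / (2 * n) * log q (2 * pi * (e / n) * (1 - e / n) * n)
      + 1 / n * log q (real q * n * d)
      + 1 / (n * ln q) * (1 / (12 * n) + 1 / (12 * real e + 1) + 1 / (12 * (real n - e) + 1))"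
  have clear: "(1 - H + 1 / (2 * N) * (X / l) + 1 / N * (Y / l) + 1 / (N * l) * G) * (N * l)
      = N * l - H * (N * l) + X / 2 + Y + G" if "N > 0" "l > 0" for N l H X Y G :: real
    using that by (simp add: field_simps)
  have "B * (n * ln q) = n * ln q - q_entropy q (e / n) * (n * ln q)
      + ln (2 * pi * e * t / n) / 2 + ln (real q * n * d)
      + (1 / (12 * real n) + 1 / (12 * real e + 1) + 1 / (12 * real t + 1))"
    unfolding B_def prod nt log_def of_nat_mult of_nat_numeral by (rule clear[OF n0 lnq])
  with main have "ln (card C) \<le> B * (n * ln q)" by (simp add: entropy)
  then have "code_rate C \<le> B"
    using n0 lnq by (simp add: code_rate_def log_def divide_le_eq mult_ac flip: q n)
  then show ?thesis by (simp add: B_def)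
qed

theorem theorem2p4:
  fixes C :: "('a::{field,finite} ^ 'n) set"
    and q n d :: nat and \<delta> :: real and e :: int
  assumes q: "q = CARD('a)"
    and n: "n = CARD('n)"
    and d: "d = min_distance C"
    and \<delta>: "\<delta> = real d / real n"
    and \<delta>_le: "\<delta> \<le> 1 - 1 / real q"
    and e: "e = \<lceil>real n * johnson_radius q \<delta>\<rceil> - 1"
    and e_ge: "e \<ge> 1"
  shows "let bound =
      1 - q_entropy q (e / n)
      + 1 / (2 * n) * log q (2 * pi * (e / n) * (1 - e / n) * n)
      + 1 / n * log q (q * n^2 * \<delta>)
      + 1 / (n * ln q) * (1 / (12 * n) + 1 / (12 * e + 1) + 1 / (12 * (n - e) + 1))
    in code_rate C \<le> bound \<and>
       Sup {code_rate C' |C' :: ('a ^ 'n) set. min_rel_distance C' = \<delta>} \<le> bound"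
proof -
  obtain k where k: "e = int k" using e_ge by (metis nonneg_int_cases order_trans zero_le_one)
  have q2: "q \<ge> 2"
    unfolding q using card_mono[of "UNIV :: 'a set" "{0, 1}"] by simp
  have n0: "real n > 0" using n by simp
  have "real_of_int e < real n * johnson_radius q \<delta>" using e by linarith
  then have less: "real k < real n * johnson_radius q \<delta>" by (simp add: k)
  note J = johnson_radius_condition[OF q2 n0 \<delta>_le less]
  have k1: "k \<ge> 1" using e_ge k by simp
  have qk: "q * k < (q - 1) * n" using J(1) by (metis of_nat_less_iff of_nat_mult)
  have "d \<noteq> 0"
  proof
    assume "d = 0"
    then have "johnson_radius q \<delta> = 0" by (simp add: \<delta> johnson_radius_def)
    with less k1 show False by simp
  qed
  then have d1: "d \<ge> 1" by simp
  have d_eq: "real d = real n * \<delta>" using n0 by (simp add: \<delta>)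
  have "\<delta> < 1"
  proof -
    have "1 / real q > 0" using q2 by simp
    with \<delta>_le show ?thesis by linarith
  qed
  then have "d < n" using n0 by (simp add: \<delta>)
  define B where "B = 1 - q_entropy q (k / n)
      + 1 / (2 * n) * log q (2 * pi * (k / n) * (1 - k / n) * n)
      + 1 / n * log q (real q * n * d)
      + 1 / (n * ln q) * (1 / (12 * n) + 1 / (12 * real k + 1) + 1 / (12 * (real n - k) + 1))"
  have nonempty: "code_rate C' \<le> B" if "C' \<noteq> {}" "\<And>c c'. c \<in> C' \<Longrightarrow> c' \<in> C' \<Longrightarrow> c \<noteq> c' \<Longrightarrow> d \<le> hamming_dist c c'"
    for C' :: "('a ^ 'n) set"
    unfolding B_def
    by (rule code_rate_le_johnson_stirling[OF q n that d1 \<open>d < n\<close> k1 qk J(2)[folded d_eq]])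
  have bound: "code_rate C' \<le> B" if "d = min_distance C'" for C' :: "('a ^ 'n) set"
  proof (cases "C' = {}")
    case True
    \<comment> \<open>Since \<open>ln 0 = 0\<close>, the empty code has the same rate \<open>0\<close> as a one-word code.\<close>
    then have "code_rate C' = code_rate {0 :: 'a ^ 'n}" by (simp add: code_rate_def log_def)
    also have "\<dots> \<le> B" by (rule nonempty) auto
    finally show ?thesis .
  next
    case False
    then show ?thesis by (rule nonempty) (use that hamming_dist_ge_min_distance in auto)
  qed
  have iff: "min_rel_distance C' = \<delta> \<longleftrightarrow> d = min_distance C'" for C' :: "('a ^ 'n) set"
    using n0 by (auto simp: min_rel_distance_def \<delta> simp flip: n)
  have sup: "Sup {code_rate C' |C' :: ('a ^ 'n) set. min_rel_distance C' = \<delta>} \<le> B"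
    by (rule cSup_least) (use d bound in \<open>auto simp: iff\<close>)
  have volume: "real (q * n\<^sup>2) * \<delta> = real q * n * d"
    using n0 by (simp add: \<delta> power2_eq_square)
  have casts: "real_of_int e = real k" "real_of_int (12 * e + 1) = 12 * real k + 1"
    "real_of_int (12 * (int n - e) + 1) = 12 * (real n - k) + 1"
    by (simp_all add: k)
  show ?thesis
    unfolding Let_def volume casts using sup bound[OF d] unfolding B_def by blast
qed

end
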